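(* Let $k, \ell, t$ be positive integers with $1 \leq t \leq \ell-1$. There exists $n_0(k,\ell,t)$ such that for every integer $n \geq n_0(k,\ell,t)$ the following holds: if $\mathcal{P}$ is a $t$-intersecting family of $(k,\ell)$-subpartitions of $[n]$, then $$|\mathcal{P}| \leq \frac{1}{(\ell-t)!} \prod_{i=t}^{\ell-1}\binom{n-ik}{k}.$$ Moreover, this bound is attained only by a canonical $t$-intersecting family of $(k,\ell)$-subpartitions, i.e. a family consisting of all $(k,\ell)$-subpartitions of $[n]$ that contain a fixed set of $t$ pairwise disjoint $k$-subsets of $[n]$ among their classes.
   Context: Let $[n]=\{1,\dots,n\}$. A $(k,\ell)$-subpartition of $[n]$ is a set $P=\{P_1,\dots,P_\ell\}$ of $\ell$ pairwise disjoint $k$-subsets of $[n]$ (called classes). Two $(k,\ell)$-subpartitions $P$ and $Q$ are $t$-intersecting if they have at least $t$ classes in common, i.e. the classes can be ordered so that $P_i=Q_i$ for $i=1,\dots,t$. A family is $t$-intersecting if every two of its members are $t$-intersecting. *)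

theory Defs
  imports Complex_Main
begin

definition subpartitions :: "nat \<Rightarrow> nat \<Rightarrow> nat \<Rightarrow> nat set set set" where
  "subpartitions n k l =
     {P. P \<subseteq> {A. A \<subseteq> {1..n} \<and> card A = k} \<and> card P = l \<and> pairwise disjnt P}"

definition t_intersecting :: "nat \<Rightarrow> 'a set set \<Rightarrow> bool" where
  "t_intersecting t F \<longleftrightarrow> (\<forall>P\<in>F. \<forall>Q\<in>F. t \<le> card (P \<inter> Q))"

text \<open>The fixed set of \<open>t\<close> pairwise disjoint \<open>k\<close>-subsets of \<open>{1..n}\<close> is itself a
  \<open>(k, t)\<close>-subpartition.\<close>

definition canonical_family :: "nat \<Rightarrow> nat \<Rightarrow> nat \<Rightarrow> nat \<Rightarrow> nat set set set \<Rightarrow> bool" where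
  "canonical_family n k l t F \<longleftrightarrow>
     (\<exists>T \<in> subpartitions n k t. F = {P \<in> subpartitions n k l. T \<subseteq> P})"

end

theory Submission
  imports Defs
begin

text \<open>If every member of \<open>F\<close> contains a common set \<open>T\<close> of \<open>t\<close> classes, then \<open>F\<close> lies in the canonical
  family of \<open>T\<close>, whose size is the stated bound.  Otherwise fix \<open>P \<in> F\<close>.  Each \<open>Q \<in> F\<close> contains one of
  the \<open>t\<close>-subsets \<open>T\<close> of \<open>P\<close>; some \<open>R \<in> F\<close> omits part of \<open>T\<close>, so \<open>Q\<close> must meet \<open>R - T\<close> in order to share
  \<open>t\<close> classes with \<open>R\<close>.  Thus \<open>Q\<close> contains one of at most \<open>(l choose t) * l\<close> prescribed sets of \<open>t + 1\<close>
  classes, and \<open>F\<close> has size \<open>O(n^(k(l-t-1)))\<close>, which is of smaller order than the bound.\<close>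

section \<open>Set systems without a common t-subset\<close>

lemma card_supersets_le:
  assumes "finite V" "card U = u"
  shows "card {Q. Q \<subseteq> V \<and> card Q = l \<and> U \<subseteq> Q} \<le> card V ^ (l - u)" (is "card ?S \<le> _")
proof -
  let ?B = "{B. B \<subseteq> V \<and> card B = l - u}"
  have inj: "inj_on (\<lambda>Q. Q - U) ?S" by (auto simp: inj_on_def)
  have "(\<lambda>Q. Q - U) ` ?S \<subseteq> ?B"
  proof (rule image_subsetI)
    fix Q assume Q: "Q \<in> ?S"
    \<comment> \<open>If \<open>u = 0\<close>, the hypothesis \<open>card U = u\<close> also allows
      an infinite \<open>U\<close>, so finiteness is taken from a superset inside
      \<open>V\<close>.\<close>
    then have "finite U" using finite_subset[OF _ assms(1), of U] by blast
    then show "Q - U \<in> ?B" using Q assms(2) card_Diff_subset[of U Q] by auto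
  qed
  then have "card ?S \<le> card ?B"
    using card_inj_on_le[OF inj] assms by simp
  also have "\<dots> = card V choose (l - u)"
    using n_subsets[OF assms(1)] by simp
  also have "\<dots> \<le> card V ^ (l - u)"
    by (cases "l - u \<le> card V") (auto simp: binomial_le_pow binomial_eq_0)
  finally show ?thesis .
qed

text \<open>The factors are the choices made in covering \<open>F\<close>: a t-subset
  \<open>T\<close> of one fixed member, then an element outside \<open>T\<close> of a member not
  containing \<open>T\<close>, then the remaining \<open>l - Suc t\<close> elements of
  \<open>V\<close>. It will be applied with the k-subsets of \<open>{1..n}\<close> as
  \<open>V\<close>.\<close>

lemma card_nontrivial_intersecting_le:
  fixes V :: "'a set"
  assumes V: "finite V" and F: "\<And>Q. Q \<in> F \<Longrightarrow> Q \<subseteq> V \<and> card Q = l"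
    and int: "t_intersecting t F"
    and nontriv: "\<And>T. card T = t \<Longrightarrow> \<exists>R\<in>F. \<not> T \<subseteq> R"
  shows "card F \<le> (l choose t) * l * card V ^ (l - Suc t)"
proof (cases "F = {}")
  case False
  then obtain P where P: "P \<in> F" by blast
  have fin: "finite Q" if "Q \<in> F" for Q using F[OF that] V finite_subset by blast
  let ?Ts = "{T. T \<subseteq> P \<and> card T = t}"
  let ?S = "\<lambda>U. {Q. Q \<subseteq> V \<and> card Q = l \<and> U \<subseteq> Q}"
  have finS: "finite (?S U)" for U
    by (rule finite_subset[of _ "Pow V"]) (use V in auto)
  obtain R where R: "\<And>T. card T = t \<Longrightarrow> R T \<in> F \<and> \<not> T \<subseteq> R T"
    using nontriv by metis
  have finT: "finite T" if "T \<in> ?Ts" for T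
    using that fin[OF P] finite_subset by blast
  have finTs: "finite ?Ts" using fin[OF P] by simp
  have finR: "finite (R T - T)" if "T \<in> ?Ts" for T
    using that R fin by blast
  have "F \<subseteq> (\<Union>T\<in>?Ts. \<Union>x\<in>R T - T. ?S (insert x T))"
  proof
    fix Q assume Q: "Q \<in> F"
    have "t \<le> card (P \<inter> Q)" using int P Q by (auto simp: t_intersecting_def)
    then obtain T where T: "T \<subseteq> P \<inter> Q" "card T = t"
      by (metis obtain_subset_with_card_n)
    have RT: "R T \<in> F" "\<not> T \<subseteq> R T" using R T(2) by auto
    have fT: "finite T" using finT T by blast
    \<comment> \<open>Some element of \<open>T\<close> lies outside \<open>R T\<close>, so such an
      inclusion would be proper and leave fewer than \<open>t\<close> common elements.\<close>
    have "\<not> Q \<inter> R T \<subseteq> T"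
    proof
      assume "Q \<inter> R T \<subseteq> T"
      then have "Q \<inter> R T \<subset> T" using RT(2) by blast
      then have "card (Q \<inter> R T) < t" using psubset_card_mono[OF fT] T(2) by blast
      then show False using int Q RT(1) by (force simp: t_intersecting_def)
    qed
    then obtain x where "x \<in> Q" "x \<in> R T - T" by blast
    then show "Q \<in> (\<Union>T\<in>?Ts. \<Union>x\<in>R T - T. ?S (insert x T))"
      using T F[OF Q] by blast
  qed
  then have "card F \<le> card (\<Union>T\<in>?Ts. \<Union>x\<in>R T - T. ?S (insert x T))"
    by (rule card_mono[rotated]) (use finTs finR finS in blast)
  also have "\<dots> \<le> (\<Sum>T\<in>?Ts. card (\<Union>x\<in>R T - T. ?S (insert x T)))"
    by (rule card_UN_le[OF finTs])
  also have "\<dots> \<le> (\<Sum>T\<in>?Ts. l * card V ^ (l - Suc t))"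
  proof (rule sum_mono)
    fix T assume T: "T \<in> ?Ts"
    have "card (\<Union>x\<in>R T - T. ?S (insert x T)) \<le> (\<Sum>x\<in>R T - T. card (?S (insert x T)))"
      by (rule card_UN_le[OF finR[OF T]])
    also have "\<dots> \<le> (\<Sum>x\<in>R T - T. card V ^ (l - Suc t))"
      by (rule sum_mono, rule card_supersets_le[OF V]) (use T finT[OF T] in auto)
    also have "\<dots> = card (R T - T) * card V ^ (l - Suc t)" by simp
    also have "\<dots> \<le> l * card V ^ (l - Suc t)"
    proof (rule mult_right_mono)
      have "R T \<in> F" using T R by blast
      then show "card (R T - T) \<le> l"
        using card_mono[OF fin, of "R T" "R T - T"] F by auto
    qed simp
    finally show "card (\<Union>x\<in>R T - T. ?S (insert x T)) \<le> l * card V ^ (l - Suc t)" .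
  qed
  also have "\<dots> = (l choose t) * l * card V ^ (l - Suc t)"
    using n_subsets[OF fin[OF P]] F[OF P] by simp
  finally show ?thesis .
qed simp

section \<open>Counting subpartitions\<close>

text \<open>The ground set is arbitrary because deleting the points of some classes from
  \<open>{1..n}\<close> leaves a set that need not be an initial interval.\<close>

definition subpartitions_of :: "'a set \<Rightarrow> nat \<Rightarrow> nat \<Rightarrow> 'a set set set" where
  "subpartitions_of X k m =
     {P. P \<subseteq> {A. A \<subseteq> X \<and> card A = k} \<and> card P = m \<and> pairwise disjnt P}"

lemma finite_subpartitions_of: "finite X \<Longrightarrow> finite (subpartitions_of X k m)"
  unfolding subpartitions_of_def
  by (rule finite_subset[of _ "Pow (Pow X)"]) auto

lemma subpartitions_eq: "subpartitions n k l = subpartitions_of {1..n} k l"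
  by (simp add: subpartitions_def subpartitions_of_def)

lemma finite_mem_subpartitions_of:
  "finite X \<Longrightarrow> P \<in> subpartitions_of X k m \<Longrightarrow> finite P"
  unfolding subpartitions_of_def by (auto intro: finite_subset[of P "Pow X"])

text \<open>Deleting the classes of \<open>T\<close> and adding them back are mutually inverse,
  since the other classes avoid all points of \<open>\<Union>T\<close>.\<close>

lemma card_subpartitions_of_containing:
  assumes X: "finite X" and k: "1 \<le> k" and T: "T \<in> subpartitions_of X k t" and tl: "t \<le> l"
  shows "card {P \<in> subpartitions_of X k l. T \<subseteq> P} =
         card (subpartitions_of (X - \<Union>T) k (l - t))"
proof (rule bij_betw_same_card[of "\<lambda>P. P - T"], rule bij_betw_byWitness[where f' = "\<lambda>P. P \<union> T"])
  let ?L = "{P \<in> subpartitions_of X k l. T \<subseteq> P}"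
  let ?R = "subpartitions_of (X - \<Union>T) k (l - t)"
  have fT: "finite T" using finite_mem_subpartitions_of[OF X T] .
  have cT: "card T = t" and subT: "T \<subseteq> {A. A \<subseteq> X \<and> card A = k}" and dT: "pairwise disjnt T"
    using T by (auto simp: subpartitions_of_def)
  \<comment> \<open>A class common to \<open>P\<close> and \<open>T\<close> would have to be empty,
    which \<open>1 \<le> k\<close> excludes.\<close>
  have disj: "P \<inter> T = {}" if "P \<in> ?R" for P
  proof (rule ccontr)
    assume "P \<inter> T \<noteq> {}"
    then obtain A where A: "A \<in> P" "A \<in> T" by blast
    then have "A \<subseteq> X - \<Union>T" "card A = k" using that by (auto simp: subpartitions_of_def)
    then have "A = {}" using A(2) by blast
    then show False using k \<open>card A = k\<close> by simp
  qed
  show "\<forall>P\<in>?L. P - T \<union> T = P" by auto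
  show "\<forall>P\<in>?R. P \<union> T - T = P" using disj by blast
  show "(\<lambda>P. P - T) ` ?L \<subseteq> ?R"
  proof (rule image_subsetI)
    fix P assume P: "P \<in> ?L"
    then have "pairwise disjnt P" "T \<subseteq> P" by (auto simp: subpartitions_of_def)
    then have "disjnt A B" if "A \<in> P - T" "B \<in> T" for A B
      using that by (metis Diff_iff pairwiseD subsetD)
    then have *: "A \<inter> B = {}" if "A \<in> P - T" "B \<in> T" for A B
      using that by (auto simp: disjnt_def)
    show "P - T \<in> ?R"
      using P * cT card_Diff_subset[OF fT, of P] unfolding subpartitions_of_def
      by (auto intro: pairwise_subset)
  qed
  show "(\<lambda>P. P \<union> T) ` ?R \<subseteq> ?L"
  proof (rule image_subsetI)
    fix P assume P: "P \<in> ?R"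
    have fP: "finite P" using finite_mem_subpartitions_of[OF _ P] X by blast
    have "card (P \<union> T) = l"
      using card_Un_disjoint[OF fP fT disj[OF P]] P cT tl by (simp add: subpartitions_of_def)
    moreover have "disjnt A B" if "A \<in> P" "B \<in> T" for A B
      using P that by (auto simp: subpartitions_of_def disjnt_def)
    then have "pairwise disjnt (P \<union> T)"
      using P dT unfolding subpartitions_of_def pairwise_def by (auto simp: disjnt_sym)
    moreover have "P \<union> T \<subseteq> {A. A \<subseteq> X \<and> card A = k}"
      using P subT by (auto simp: subpartitions_of_def)
    ultimately show "P \<union> T \<in> ?L" by (simp add: subpartitions_of_def)
  qed
qed

text \<open>Both sides count ordered choices of \<open>m\<close> disjoint classes: after
  \<open>i\<close> of them, \<open>card X - i * k\<close> points remain. If the points run out,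
  truncated subtraction gives a zero factor because \<open>1 \<le> k\<close>.\<close>

lemma card_subpartitions_of:
  assumes "finite X" "1 \<le> k"
  shows "fact m * card (subpartitions_of X k m) = (\<Prod>i<m. (card X - i * k) choose k)"
  using assms(1)
proof (induction m arbitrary: X)
  case 0
  have "subpartitions_of X k 0 = {{}}"
  proof -
    have "P = {}" if "P \<in> subpartitions_of X k 0" for P
      using that finite_mem_subpartitions_of[OF 0 that] by (simp add: subpartitions_of_def)
    then show ?thesis by (auto simp: subpartitions_of_def)
  qed
  then show ?case by simp
next
  case (Suc m)
  let ?K = "{A. A \<subseteq> X \<and> card A = k}"
  let ?S = "subpartitions_of X k (Suc m)"
  have finK: "finite ?K" using Suc.prems by simp
  \<comment> \<open>Double counting of the pairs \<open>(A, P)\<close> with \<open>A \<in> P\<close>.\<close>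
  have "Suc m * card ?S = (\<Sum>P\<in>?S. card {A \<in> ?K. A \<in> P})"
  proof -
    have "card {A \<in> ?K. A \<in> P} = Suc m" if "P \<in> ?S" for P
    proof -
      have "{A \<in> ?K. A \<in> P} = P" using that by (auto simp: subpartitions_of_def)
      then show ?thesis using that by (simp add: subpartitions_of_def)
    qed
    then show ?thesis by simp
  qed
  also have "\<dots> = (\<Sum>A\<in>?K. card {P \<in> ?S. A \<in> P})"
    using sum.swap_restrict[OF finite_subpartitions_of[OF Suc.prems] finK,
      where g = "\<lambda>_ _. 1" and R = "\<lambda>P A. A \<in> P"]
    by (simp only: card_eq_sum)
  also have "\<dots> = (\<Sum>A\<in>?K. card (subpartitions_of (X - A) k m))"
  proof (rule sum.cong[OF refl])
    fix A assume "A \<in> ?K"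
    then have "{A} \<in> subpartitions_of X k 1" by (simp add: subpartitions_of_def)
    from card_subpartitions_of_containing[OF Suc.prems assms(2) this, of "Suc m"]
    show "card {P \<in> ?S. A \<in> P} = card (subpartitions_of (X - A) k m)" by simp
  qed
  finally have "fact m * (Suc m * card ?S) = (\<Sum>A\<in>?K. fact m * card (subpartitions_of (X - A) k m))"
    by (simp only: sum_distrib_left)
  then have "fact (Suc m) * card ?S = (\<Sum>A\<in>?K. fact m * card (subpartitions_of (X - A) k m))"
    by (simp only: fact_Suc of_nat_id mult_ac)
  also have "\<dots> = (\<Sum>A\<in>?K. \<Prod>i<m. (card X - Suc i * k) choose k)"
  proof (rule sum.cong[OF refl])
    fix A assume A: "A \<in> ?K"
    then have "card (X - A) = card X - k"
      using card_Diff_subset[of A X] finite_subset[OF _ Suc.prems] by auto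
    then show "fact m * card (subpartitions_of (X - A) k m) = (\<Prod>i<m. (card X - Suc i * k) choose k)"
      using Suc.IH[of "X - A"] Suc.prems by (simp add: diff_diff_left)
  qed
  also have "\<dots> = (card X choose k) * (\<Prod>i<m. (card X - Suc i * k) choose k)"
    using n_subsets[OF Suc.prems] by simp
  also have "\<dots> = (\<Prod>i<Suc m. (card X - i * k) choose k)"
    by (subst prod.lessThan_Suc_shift) simp
  finally show ?case .
qed

text \<open>The disjoint classes of \<open>T\<close> use up \<open>t * k\<close> points, so the
  product for the remaining \<open>l - t\<close> classes has its index shifted by
  \<open>t\<close>.\<close>

lemma card_canonical_family:
  assumes k: "1 \<le> k" and tl: "t < l" and T: "T \<in> subpartitions n k t"
  shows "real (card {P \<in> subpartitions n k l. T \<subseteq> P}) =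
         1 / fact (l - t) * (\<Prod>i=t..l - 1. real ((n - i * k) choose k))"
proof -
  let ?X = "{1..n} - \<Union>T"
  have T': "T \<subseteq> {A. A \<subseteq> {1..n} \<and> card A = k}" "card T = t" "pairwise disjnt T"
    using T by (auto simp: subpartitions_def)
  have finA: "finite A" if "A \<in> T" for A using that T'(1) finite_subset[of A "{1..n}"] by blast
  have UT: "\<Union>T \<subseteq> {1..n}" using T'(1) by blast
  have "card (\<Union>T) = sum card T" by (rule card_Union_disjoint[OF T'(3) finA])
  also have "\<dots> = (\<Sum>A\<in>T. k)" by (rule sum.cong) (use T'(1) in auto)
  also have "\<dots> = t * k" using T'(2) by simp
  finally have "card ?X = n - t * k"
    using card_Diff_subset[of "\<Union>T" "{1..n}"] finite_subset[OF UT] UT by simp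
  then have "fact (l - t) * card (subpartitions_of ?X k (l - t)) =
      (\<Prod>i<l - t. (n - (i + t) * k) choose k)"
    using card_subpartitions_of[OF _ k, of ?X "l - t"] by (simp add: algebra_simps)
  also have "\<dots> = (\<Prod>i=t..l - 1. (n - i * k) choose k)"
    by (rule prod.reindex_bij_witness[of _ "\<lambda>i. i - t" "\<lambda>i. i + t"]) (use tl in auto)
  finally have "real (fact (l - t) * card (subpartitions_of ?X k (l - t))) =
      real (\<Prod>i=t..l - 1. (n - i * k) choose k)" by (rule arg_cong)
  then show ?thesis
    using card_subpartitions_of_containing[of "{1..n}" k T t l] k tl T
    by (simp add: subpartitions_eq field_simps)
qed

section \<open>Comparison of the two bounds for large n\<close>

text \<open>The left side is at most \<open>D * n ^ (k * (l - Suc t))\<close>. On the right each of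
  the \<open>l - t\<close> binomials is at least \<open>(n / (2 * k)) ^ k\<close>, which gains a
  factor of order \<open>n ^ k\<close>.\<close>

lemma nontrivial_bound_less:
  fixes k l t n D :: nat
  assumes k: "1 \<le> k" and tl: "t < l" and n1: "2 * l * k \<le> n"
    and n2: "D * fact (l - t) * (2 * k) ^ (k * (l - t)) < n"
  shows "real (D * (n choose k) ^ (l - Suc t)) <
         1 / fact (l - t) * (\<Prod>i=t..l - 1. real ((n - i * k) choose k))"
proof -
  define d where "d = l - Suc t"
  have d: "l - t = Suc d" using tl by (simp add: d_def)
  have n0: "0 < n" using n2 by simp
  let ?a = "(real n / (2 * real k)) ^ k"
  have a0: "0 < ?a" using n0 k by simp
  have a: "?a \<le> real ((n - i * k) choose k)" if "i \<in> {t..l - 1}" for i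
  proof -
    \<comment> \<open>Using \<open>Suc i\<close> instead of \<open>i\<close> yields both
      \<open>n - i * k \<ge> n / 2\<close> and \<open>k \<le> n - i * k\<close>, the latter being
      required by the binomial lower bound.\<close>
    have il: "Suc i \<le> l" using that tl by auto
    then have "Suc i * k \<le> l * k" by (rule mult_le_mono1)
    then have le: "2 * (Suc i * k) \<le> n" using n1 by simp
    then have "n \<le> 2 * (n - i * k)" by simp
    then have "real n \<le> 2 * real (n - i * k)" by linarith
    then have "?a \<le> (real (n - i * k) / real k) ^ k"
      using k by (intro power_mono) (auto simp: field_simps)
    also have "\<dots> \<le> real ((n - i * k) choose k)"
      by (rule binomial_ge_n_over_k_pow_k) (use le in auto)
    finally show ?thesis .
  qed
  have "k \<le> l * k" using tl by simp
  then have "k \<le> n" using n1 by linarith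
  then have "n choose k \<le> n ^ k" by (rule binomial_le_pow)
  then have "D * (n choose k) ^ d \<le> D * (n ^ k) ^ d" by (simp add: power_mono)
  then have "real (D * (n choose k) ^ d) \<le> real (D * (n ^ k) ^ d)" by (simp only: of_nat_le_iff)
  also have "\<dots> < 1 / fact (l - t) * ?a ^ Suc d"
  proof -
    \<comment> \<open>The assumption on \<open>n\<close> suffices because
      \<open>n \<le> n ^ k\<close>.\<close>
    have "D * fact (l - t) * (2 * k) ^ (k * Suc d) < n ^ k"
      using n2 self_le_power[of n k] n0 k d by (metis One_nat_def Suc_leI less_le_trans zero_less_one)
    then have "D * fact (l - t) * (2 * k) ^ (k * Suc d) * (n ^ k) ^ d < n ^ k * (n ^ k) ^ d"
      using n0 by simp
    then have "real (D * fact (l - t) * (2 * k) ^ (k * Suc d) * (n ^ k) ^ d) < real (n ^ k * (n ^ k) ^ d)"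
      by (simp only: of_nat_less_iff)
    then have *: "real D * fact (l - t) * (2 * real k) ^ (k * Suc d) * real ((n ^ k) ^ d)
        < real (n ^ k) ^ Suc d"
      by simp
    have "?a ^ Suc d = real (n ^ k) ^ Suc d / (2 * real k) ^ (k * Suc d)"
      by (simp only: power_divide power_mult of_nat_power)
    moreover have "0 < (2 * real k) ^ (k * Suc d)" using k by simp
    ultimately show ?thesis
      using * by (simp only: of_nat_mult) (simp add: field_simps del: power_Suc of_nat_power)
  qed
  also have "\<dots> \<le> 1 / fact (l - t) * (\<Prod>i=t..l - 1. real ((n - i * k) choose k))"
  proof (rule mult_left_mono)
    have "?a ^ Suc d = (\<Prod>i=t..l - 1. ?a)" using tl by (simp add: d_def Suc_diff_Suc)
    also have "\<dots> \<le> (\<Prod>i=t..l - 1. real ((n - i * k) choose k))"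
      by (rule prod_mono) (use a a0 in \<open>auto intro: less_imp_le\<close>)
    finally show "?a ^ Suc d \<le> (\<Prod>i=t..l - 1. real ((n - i * k) choose k))" .
  qed simp
  finally show ?thesis by (simp only: d_def)
qed

section \<open>Choice of the threshold and the case of equality\<close>

theorem theorem2:
  fixes k l t :: nat
  assumes "1 \<le> k" and "1 \<le> t" and "t \<le> l - 1"
  shows "\<exists>n0::nat. \<forall>n\<ge>n0. \<forall>F. F \<subseteq> subpartitions n k l \<longrightarrow> t_intersecting t F \<longrightarrow>
           real (card F) \<le> 1 / fact (l - t) * (\<Prod>i=t..l - 1. real ((n - i * k) choose k)) \<and>
           (real (card F) = 1 / fact (l - t) * (\<Prod>i=t..l - 1. real ((n - i * k) choose k)) \<longleftrightarrow>
              canonical_family n k l t F)"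
proof -
  have tl: "t < l" using assms by simp
  define D where "D = (l choose t) * l"
  \<comment> \<open>The first summand keeps \<open>n - i * k\<close> at least \<open>n / 2\<close>
    for \<open>i < l\<close>; the second makes the bound for nontrivial families strictly smaller
    than \<open>?b\<close>. Their sum serves as a common upper bound.\<close>
  define n0 where "n0 = 2 * l * k + Suc (D * fact (l - t) * (2 * k) ^ (k * (l - t)))"
  show ?thesis
  proof (rule exI[of _ n0], intro allI impI)
    fix n F
    assume n: "n0 \<le> n" and F: "F \<subseteq> subpartitions n k l" and int: "t_intersecting t F"
    let ?b = "1 / fact (l - t) * (\<Prod>i=t..l - 1. real ((n - i * k) choose k))"
    let ?C = "\<lambda>T. {P \<in> subpartitions n k l. T \<subseteq> P}"
    have less: "real (D * (n choose k) ^ (l - Suc t)) < ?b"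
      by (rule nontrivial_bound_less[OF assms(1) tl]) (use n in \<open>auto simp: n0_def\<close>)
    have canon: "real (card F) = ?b" if "canonical_family n k l t F"
      using that card_canonical_family[OF assms(1) tl] by (auto simp: canonical_family_def)
    show "real (card F) \<le> ?b \<and> (real (card F) = ?b \<longleftrightarrow> canonical_family n k l t F)"
    \<comment> \<open>The empty family would satisfy the second condition vacuously; a member of
      \<open>F\<close> is needed to see that \<open>T\<close> consists of disjoint k-sets.\<close>
    proof (cases "F \<noteq> {} \<and> (\<exists>T. card T = t \<and> (\<forall>R\<in>F. T \<subseteq> R))")
      case True
      then obtain T P where T: "card T = t" "\<forall>R\<in>F. T \<subseteq> R" and P: "P \<in> F" by blast
      have "T \<subseteq> P" "P \<in> subpartitions n k l" using T P F by auto
      then have Tsub: "T \<in> subpartitions n k t"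
        using T(1) by (auto simp: subpartitions_def intro: pairwise_subset)
      have FC: "F \<subseteq> ?C T" using F T(2) by blast
      have fC: "finite (?C T)" using finite_subpartitions_of[of "{1..n}"] by (simp add: subpartitions_eq)
      have cC: "real (card (?C T)) = ?b" by (rule card_canonical_family[OF assms(1) tl Tsub])
      have "card F \<le> card (?C T)" by (rule card_mono[OF fC FC])
      moreover have "canonical_family n k l t F" if "real (card F) = ?b"
      proof -
        have "card F = card (?C T)" using that cC by linarith
        then have "F = ?C T" by (rule card_subset_eq[OF fC FC])
        then show ?thesis using Tsub by (auto simp: canonical_family_def)
      qed
      ultimately show ?thesis using cC canon by auto
    next
      case False
      let ?V = "{A. A \<subseteq> {1..n} \<and> card A = k}"
      have V: "Q \<subseteq> ?V \<and> card Q = l" if "Q \<in> F" for Q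
        using F that unfolding subpartitions_def by blast
      have "card F \<le> D * (n choose k) ^ (l - Suc t)"
      proof (cases "F = {}")
        case False
        have "card F \<le> (l choose t) * l * card ?V ^ (l - Suc t)"
          by (rule card_nontrivial_intersecting_le[OF _ V int])
            (use False \<open>\<not> (F \<noteq> {} \<and> _)\<close> in auto)
        then show ?thesis using n_subsets[of "{1..n}" k] by (simp add: D_def)
      qed simp
      then have "real (card F) < ?b" using less by (meson of_nat_mono order_le_less_trans)
      \<comment> \<open>Strict inequality makes both sides of the equivalence false: by
        \<open>canon\<close>, a canonical family would attain \<open>?b\<close>.\<close>
      then show ?thesis using canon by auto
    qed
  qed
qed

end
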